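(* Let $k\geq 3$, let $N$ be a large positive integer, let $f$ be a real function on $(0,3N)$ with continuous derivatives of order up to $k$, and define $\mathcal{R}(f,N,\delta):=\#\{n\in[N,2N]\cap\mathbb{Z}:\ \|f(n)\|<\delta\}$. Suppose there exist real numbers $\lambda,A>0$ such that $\lambda\leq f^{(k)}(x)\leq A\lambda\leq c_{0}$ for all $x\in(0,3N)$, where $c_{0}<1/4$ is a suitable small constant, and assume $(A\lambda)^{-2/k(k+1)}\leq N$. Let $\lambda_{1}>0$ be such that $|f'(x)|\leq\lambda_{1}$ for all $x\in(0,3N)$. Assume $0<\delta<1/4$ is such that \[ A\lambda\ll\delta+\lambda_{1}\ll(A\lambda)^{1-2(k-1)/k(k+1)}. \] Then \[ \mathcal{R}(f,N,\delta)\ll 1+A(1+A\lambda N)\big((\delta+\lambda_{1})/A\lambda\big)^{1/(k-1)}. \]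
   Context: $\|\alpha\|$ denotes the distance from the real number $\alpha$ to the nearest integer. Implicit constants depend only on $k$. *)

theory Defs
  imports "HOL-Analysis.Analysis"
begin

definition nearest_int_dist :: "real \<Rightarrow> real" where
  "nearest_int_dist \<alpha> = infdist \<alpha> \<int>"

text \<open>
  Continuous derivatives of order up to \<open>k\<close>. The iterated \<^const>\<open>deriv\<close> at a point of an open set
  depends only on the values of the function near that point, so for open \<open>S\<close> this
  is a condition on the restriction of \<open>f\<close> to \<open>S\<close>.
\<close>

definition cont_derivs_on :: "nat \<Rightarrow> (real \<Rightarrow> real) \<Rightarrow> real set \<Rightarrow> bool" where
  "cont_derivs_on k f S \<longleftrightarrow>
     (\<forall>j<k. (deriv ^^ j) f differentiable_on S) \<and>
     (\<forall>j\<le>k. continuous_on S ((deriv ^^ j) f))"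

definition near_int_count :: "(real \<Rightarrow> real) \<Rightarrow> nat \<Rightarrow> real \<Rightarrow> nat" where
  "near_int_count f N \<delta> =
     card {n :: int. int N \<le> n \<and> n \<le> 2 * int N \<and> nearest_int_dist (f (real_of_int n)) < \<delta>}"

end

theory Submission
  imports Defs
begin

text \<open>
  A function bounded by \<open>\<lambda>\<^sub>1\<close> on an interval of length comparable to \<open>N\<close>, with derivative of order
  \<open>k - 1\<close> at least \<open>\<lambda>\<close> there, forces \<open>\<lambda> N ^ (k - 1) \<lless> \<lambda>\<^sub>1\<close>, as a finite difference of order
  \<open>k - 1\<close> shows. For the function \<open>f'\<close> this gives \<open>N \<lless> (\<lambda>\<^sub>1 / \<lambda>) powr (1 / (k - 1))\<close>, and since \<open>A \<ge> 1\<close>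
  the trivial bound \<open>N + 1\<close> for the number of integers in \<open>[N, 2N]\<close> is already of the required size.
\<close>

text \<open>The forward difference of order \<open>m\<close> of \<open>G 0\<close> with step
  \<open>h\<close> is at least \<open>l * h ^ m\<close> by repeated use of the mean value theorem,
  and at most \<open>2 ^ m * M\<close> by the triangle inequality.\<close>

lemma higher_deriv_lower_bound_le:
  fixes G :: "nat \<Rightarrow> real \<Rightarrow> real"
  assumes "\<And>j x. j < m \<Longrightarrow> x \<in> {a<..<b} \<Longrightarrow> (G j has_real_derivative G (Suc j) x) (at x)"
    and "\<And>x. x \<in> {a<..<b} \<Longrightarrow> l \<le> G m x"
    and "\<And>x. x \<in> {a<..<b} \<Longrightarrow> \<bar>G 0 x\<bar> \<le> M"
    and "0 < h" and "a + real m * h < b"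
  shows "l * h ^ m \<le> 2 ^ m * M"
  using assms
proof (induction m arbitrary: G b l M)
  case 0
  \<comment> \<open>Without differencing, a single point of the nonempty interval gives
    \<open>l \<le> G 0 x \<le> M\<close>.\<close>
  define x where "x = (a + b) / 2"
  have "x \<in> {a<..<b}"
    using "0.prems"(5) by (simp add: x_def)
  with "0.prems"(2,3)[of x] show ?case by simp
next
  case (Suc m)
  \<comment> \<open>One differencing turns \<open>l\<close> into \<open>l * h\<close> and
    \<open>M\<close> into \<open>2 * M\<close>. The right end drops to \<open>b - h\<close> so that
    \<open>x + h\<close> stays in the original interval.\<close>
  define D where "D = (\<lambda>j x. G j (x + h) - G j x)"
  have "(l * h) * h ^ m \<le> 2 ^ m * (2 * M)"
  proof (rule Suc.IH[where G = D and b = "b - h"])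
    fix j x assume "j < m" and x: "x \<in> {a<..<b - h}"
    then have "(G j has_real_derivative G (Suc j) (x + h)) (at (x + h))"
      and "(G j has_real_derivative G (Suc j) x) (at x)"
      using \<open>0 < h\<close> by (auto intro: Suc.prems(1))
    then show "(D j has_real_derivative D (Suc j) x) (at x)"
      unfolding D_def by (intro DERIV_diff DERIV_shift[THEN iffD1])
  next
    fix x assume x: "x \<in> {a<..<b - h}"
    have "\<exists>z. x < z \<and> z < x + h \<and> G m (x + h) - G m x = (x + h - x) * G (Suc m) z"
    proof (rule MVT2)
      show "x < x + h" using \<open>0 < h\<close> by simp
      show "(G m has_real_derivative G (Suc m) y) (at y)" if "x \<le> y" "y \<le> x + h" for y
        using that x by (intro Suc.prems(1)) auto
    qed
    then obtain z where z: "x < z" "z < x + h" "D m x = h * G (Suc m) z"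
      by (auto simp: D_def)
    then have "l \<le> G (Suc m) z"
      using x by (intro Suc.prems(2)) auto
    with z \<open>0 < h\<close> show "l * h \<le> D m x"
      by (simp add: mult.commute)
  next
    fix x assume x: "x \<in> {a<..<b - h}"
    then have "\<bar>G 0 (x + h)\<bar> \<le> M" "\<bar>G 0 x\<bar> \<le> M"
      using \<open>0 < h\<close> by (auto intro: Suc.prems(3))
    then show "\<bar>D 0 x\<bar> \<le> 2 * M"
      unfolding D_def by linarith
  next
    show "0 < h" by fact
    show "a + real m * h < b - h"
      using Suc.prems(5) by (simp add: algebra_simps)
  qed
  then show ?case by (simp add: mult_ac)
qed

lemma cont_derivs_on_has_derivative:
  assumes "cont_derivs_on k f S" "open S" "j < k" "x \<in> S"
  shows "((deriv ^^ j) f has_real_derivative (deriv ^^ Suc j) f x) (at x)"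
proof -
  have "(deriv ^^ j) f differentiable (at x within S)"
    using assms(1,3,4) unfolding cont_derivs_on_def differentiable_on_def by blast
  then have "(deriv ^^ j) f differentiable (at x)"
    by (simp only: at_within_open[OF assms(4,2)])
  then show ?thesis
    by (simp add: DERIV_deriv_iff_real_differentiable)
qed

lemma near_int_count_le: "near_int_count f N \<delta> \<le> N + 1"
proof -
  have "near_int_count f N \<delta> \<le> card {int N..2 * int N}"
    unfolding near_int_count_def by (intro card_mono subsetI) simp_all
  also have "\<dots> = N + 1"
    by (simp only: card_atLeastAtMost_int)
  finally show ?thesis .
qed

text \<open>Differences of order \<open>k - 1\<close> are applied to \<open>deriv f\<close>, with a
  step proportional to \<open>N\<close>; a root of order \<open>k - 1\<close> then isolates
  \<open>N\<close>.\<close>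

lemma length_le_deriv_ratio:
  assumes "k \<ge> 2" "cont_derivs_on k f {0<..<3 * real N}" "0 < N" "0 < l"
    and lower: "\<And>x. x \<in> {0<..<3 * real N} \<Longrightarrow> l \<le> (deriv ^^ k) f x"
    and upper: "\<And>x. x \<in> {0<..<3 * real N} \<Longrightarrow> \<bar>deriv f x\<bar> \<le> M"
  shows "real N \<le> 2 * (real k - 1) * (M / l) powr (1 / (real k - 1))"
proof -
  define m where "m = k - 1"
  have m: "k = Suc m" "0 < m" "real m = real k - 1"
    using \<open>k \<ge> 2\<close> by (auto simp: m_def)
  \<comment> \<open>The \<open>m\<close> steps of length \<open>h\<close> span exactly
    \<open>N\<close>, which fits strictly inside an interval of length \<open>3 * N\<close>. The
    constant \<open>2 * m\<close> arises from \<open>h / 2 = N / (2 * m)\<close>.\<close>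
  define h where "h = real N / real m"
  have "0 < h"
    using m(2) \<open>0 < N\<close> by (simp add: h_def)
  have le: "l * h ^ m \<le> 2 ^ m * M"
  proof (rule higher_deriv_lower_bound_le[where G = "\<lambda>j. (deriv ^^ Suc j) f"])
    show "((deriv ^^ Suc j) f has_real_derivative (deriv ^^ Suc (Suc j)) f x) (at x)"
      if "j < m" "x \<in> {0<..<3 * real N}" for j x
      using that m(1) by (intro cont_derivs_on_has_derivative[OF assms(2)]) auto
    show "l \<le> (deriv ^^ Suc m) f x" if "x \<in> {0<..<3 * real N}" for x
      using lower[OF that] unfolding m(1) .
    show "\<bar>(deriv ^^ Suc 0) f x\<bar> \<le> M" if "x \<in> {0<..<3 * real N}" for x
      using upper[OF that] by simp
    show "0 < h" by fact
    show "0 + real m * h < 3 * real N"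
      using m(2) \<open>0 < N\<close> by (simp add: h_def)
  qed
  then have "(h / 2) ^ m \<le> M / l"
    using \<open>0 < l\<close> by (simp add: field_simps)
  then have "((h / 2) ^ m) powr (1 / real m) \<le> (M / l) powr (1 / real m)"
    using \<open>0 < h\<close> by (intro powr_mono2) auto
  moreover have "((h / 2) ^ m) powr (1 / real m) = h / 2"
    using \<open>0 < h\<close> m(2) by (simp add: powr_powr flip: powr_realpow)
  ultimately have "h \<le> 2 * (M / l) powr (1 / real m)" by simp
  then show ?thesis
    unfolding m(3)[symmetric] using \<open>0 < m\<close> by (simp add: h_def field_simps)
qed

theorem theorem5p3:
  fixes k :: nat
  assumes "k \<ge> 3"
  shows "\<exists>(c\<^sub>0 :: real) (N\<^sub>0 :: nat). 0 < c\<^sub>0 \<and> c\<^sub>0 < 1 / 4 \<and>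
    (\<forall>(C\<^sub>1 :: real) > 0. \<forall>(C\<^sub>2 :: real) > 0. \<exists>(C :: real) > 0.
      \<forall>(N :: nat) (f :: real \<Rightarrow> real) (l :: real) (A :: real) (l\<^sub>1 :: real) (\<delta> :: real).
        0 < N \<and> N\<^sub>0 \<le> N \<and>
        cont_derivs_on k f {0<..<3 * real N} \<and>
        0 < l \<and> 0 < A \<and>
        (\<forall>x\<in>{0<..<3 * real N}. l \<le> (deriv ^^ k) f x \<and> (deriv ^^ k) f x \<le> A * l) \<and>
        A * l \<le> c\<^sub>0 \<and>
        (A * l) powr (- (2 / (real k * (real k + 1)))) \<le> real N \<and>
        0 < l\<^sub>1 \<and>
        (\<forall>x\<in>{0<..<3 * real N}. \<bar>deriv f x\<bar> \<le> l\<^sub>1) \<and>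
        0 < \<delta> \<and> \<delta> < 1 / 4 \<and>
        A * l \<le> C\<^sub>1 * (\<delta> + l\<^sub>1) \<and>
        \<delta> + l\<^sub>1 \<le> C\<^sub>2 * (A * l) powr (1 - 2 * (real k - 1) / (real k * (real k + 1)))
        \<longrightarrow> real (near_int_count f N \<delta>)
              \<le> C * (1 + A * (1 + A * l * real N)
                        * ((\<delta> + l\<^sub>1) / (A * l)) powr (1 / (real k - 1))))"
proof (rule exI[of _ "1 / 8"], rule exI[of _ 0], intro conjI allI impI)
  fix C\<^sub>1 C\<^sub>2 :: real
  let ?p = "1 / (real k - 1)"
  \<comment> \<open>This is the constant of \<open>length_le_deriv_ratio\<close>, depending on
    \<open>k\<close> alone.\<close>
  let ?C = "2 * (real k - 1)"
  show "\<exists>(C :: real) > 0.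
      \<forall>(N :: nat) (f :: real \<Rightarrow> real) (l :: real) (A :: real) (l\<^sub>1 :: real) (\<delta> :: real).
        0 < N \<and> 0 \<le> N \<and>
        cont_derivs_on k f {0<..<3 * real N} \<and>
        0 < l \<and> 0 < A \<and>
        (\<forall>x\<in>{0<..<3 * real N}. l \<le> (deriv ^^ k) f x \<and> (deriv ^^ k) f x \<le> A * l) \<and>
        A * l \<le> 1 / 8 \<and>
        (A * l) powr (- (2 / (real k * (real k + 1)))) \<le> real N \<and>
        0 < l\<^sub>1 \<and>
        (\<forall>x\<in>{0<..<3 * real N}. \<bar>deriv f x\<bar> \<le> l\<^sub>1) \<and>
        0 < \<delta> \<and> \<delta> < 1 / 4 \<and>
        A * l \<le> C\<^sub>1 * (\<delta> + l\<^sub>1) \<and>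
        \<delta> + l\<^sub>1 \<le> C\<^sub>2 * (A * l) powr (1 - 2 * (real k - 1) / (real k * (real k + 1)))
        \<longrightarrow> real (near_int_count f N \<delta>)
              \<le> C * (1 + A * (1 + A * l * real N)
                        * ((\<delta> + l\<^sub>1) / (A * l)) powr (1 / (real k - 1)))"
  proof (rule exI[of _ ?C], intro conjI allI impI, goal_cases)
    case 1
    show ?case using assms by simp
  next
    case (2 N f l A l\<^sub>1 \<delta>)
    define Q where "Q = ((\<delta> + l\<^sub>1) / (A * l)) powr ?p"
    have "0 < N" "0 < l" "0 < A" "0 < l\<^sub>1" "0 < \<delta>" and f: "cont_derivs_on k f {0<..<3 * real N}"
      and bounds: "\<And>x. x \<in> {0<..<3 * real N} \<Longrightarrow> l \<le> (deriv ^^ k) f x \<and> (deriv ^^ k) f x \<le> A * l"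
      and upper: "\<And>x. x \<in> {0<..<3 * real N} \<Longrightarrow> \<bar>deriv f x\<bar> \<le> l\<^sub>1"
      using 2 by auto
    have "real N \<in> {0<..<3 * real N}"
      using \<open>0 < N\<close> by simp
    \<comment> \<open>Comparing the two bounds on the derivative of order \<open>k\<close> at one
      point forces \<open>A \<ge> 1\<close>.\<close>
    from bounds[OF this] have "1 * l \<le> A * l" by linarith
    then have "1 \<le> A"
      using \<open>0 < l\<close> by simp
    have "real N \<le> ?C * (l\<^sub>1 / l) powr ?p"
      using assms f \<open>0 < N\<close> \<open>0 < l\<close> bounds upper by (intro length_le_deriv_ratio) auto
    also have "\<dots> \<le> ?C * (A * (1 + A * l * real N) * Q)"
    proof (rule mult_left_mono)
      \<comment> \<open>Since \<open>\<delta> > 0\<close>, \<open>l\<^sub>1\<close> is enlarged to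
        \<open>\<delta> + l\<^sub>1\<close>; a factor \<open>A\<close> is split off to produce the
        ratio in \<open>Q\<close>.\<close>
      have "(l\<^sub>1 / l) powr ?p \<le> (A * ((\<delta> + l\<^sub>1) / (A * l))) powr ?p"
        using assms \<open>0 < l\<close> \<open>0 < A\<close> \<open>0 < l\<^sub>1\<close> \<open>0 < \<delta>\<close>
        by (intro powr_mono2) (auto simp: divide_right_mono)
      also have "\<dots> = A powr ?p * Q"
        unfolding Q_def by (rule powr_mult)
      also have "\<dots> \<le> A * (1 + A * l * real N) * Q"
      proof (rule mult_right_mono)
        \<comment> \<open>Here \<open>?p \<le> 1\<close> because \<open>k \<ge> 3\<close>, so
          \<open>A \<ge> 1\<close> permits raising the exponent to 1.\<close>
        have "A powr ?p \<le> A powr 1"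
          using \<open>1 \<le> A\<close> assms by (intro powr_mono) auto
        also have "\<dots> \<le> A * (1 + A * l * real N)"
          using \<open>0 < A\<close> \<open>0 < l\<close> by simp
        finally show "A powr ?p \<le> A * (1 + A * l * real N)" .
      qed (simp add: Q_def)
      finally show "(l\<^sub>1 / l) powr ?p \<le> A * (1 + A * l * real N) * Q" .
    qed (use assms in simp)
    finally have "real N \<le> ?C * (A * (1 + A * l * real N) * Q)" .
    \<comment> \<open>The extra 1 in the trivial count \<open>N + 1\<close> is absorbed by the
      leading 1 of the target bound, scaled by \<open>?C\<close>.\<close>
    moreover have "1 \<le> ?C"
      using assms by simp
    ultimately have "real N + 1 \<le> ?C * (A * (1 + A * l * real N) * Q) + ?C"
      by (rule add_mono)
    also have "\<dots> = ?C * (1 + A * (1 + A * l * real N) * Q)"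
      by (simp only: distrib_left[of ?C] mult_1_right add.commute)
    finally have "real N + 1 \<le> ?C * (1 + A * (1 + A * l * real N) * Q)" .
    moreover have "real (near_int_count f N \<delta>) \<le> real N + 1"
      using near_int_count_le[of f N \<delta>] by linarith
    ultimately have "real (near_int_count f N \<delta>) \<le> ?C * (1 + A * (1 + A * l * real N) * Q)"
      by (rule order_trans[rotated])
    then show ?case unfolding Q_def .
  qed
qed (simp, simp)

end
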